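(* Let $k\geqslant 2$ be an integer. For all $z\in\mathbb C$ with $|z|\leqslant 1$, $$\sum_{m=0}^{\infty}e_{k,m}z^{m}=\prod_{p} \Bigl(1+\frac{(p-1)(z-1)}{p^{k+1}} \Bigr).$$
   Context: For a positive integer $n$, $\omega_k(n)$ is the number of primes $p$ with $p^k\,\|\,n$ (primes dividing $n$ with multiplicity exactly $k$). For integers $m\geqslant0$, $e_{k,m}=\lim_{x\to\infty}\frac1x\#\{n\leqslant x:\omega_k(n)=m\}$ is the natural density of the positive integers $n$ with $\omega_k(n)=m$ (this limit exists). $\prod_p$ denotes a product over all primes. By convention $z^0=1$. *)

theory Defs
  imports "HOL-Analysis.Analysis" "HOL-Computational_Algebra.Primes"
begin

definition omega :: "nat \<Rightarrow> nat \<Rightarrow> nat" where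
  "omega k n = card {p \<in> prime_factors n. multiplicity p n = k}"

text \<open>
  As usual for \<^const>\<open>Lim\<close>, this is meaningful only for sets whose density exists.
\<close>
definition natural_density :: "nat set \<Rightarrow> real" where
  "natural_density A =
     Lim at_top (\<lambda>x::real. real (card {n \<in> A. 1 \<le> n \<and> real n \<le> x}) / x)"

definition omega_density :: "nat \<Rightarrow> nat \<Rightarrow> real" where
  "omega_density k m = natural_density {n. n \<ge> 1 \<and> omega k n = m}"

text \<open>
  The product over all primes in increasing order, as a product over \<^typ>\<open>nat\<close> with
  factor \<open>1\<close> at the non-primes.
\<close>
definition euler_factor :: "nat \<Rightarrow> complex \<Rightarrow> nat \<Rightarrow> complex" where
  "euler_factor k z p =
     (if prime p then 1 + (of_nat p - 1) * (z - 1) / of_nat p ^ (k + 1) else 1)"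

end

theory Submission
  imports Defs "HOL-Number_Theory.Cong" "HOL-Real_Asymp.Real_Asymp"
begin

text \<open>
  Cut the count of primes off at a bound \<open>y\<close>: let \<open>\<omega>\<^sub>y(n)\<close> be the number of primes \<open>p \<le> y\<close> with
  \<open>p^k\<close> exactly dividing \<open>n\<close>. Whether \<open>p^k\<close> exactly divides \<open>n\<close> depends only on \<open>n\<close> modulo
  \<open>p^(k+1)\<close>, and it holds for \<open>p - 1\<close> of the \<open>p^(k+1)\<close> residues. By the Chinese remainder theorem
  these events are independent for different \<open>p\<close>, so the mean value of \<open>z^\<omega>\<^sub>y(n)\<close> over \<open>n\<close> is the
  finite product of the Euler factors over \<open>p \<le> y\<close> (\<open>mean_omega_upto_generating\<close>).

  What makes the truncation harmless is that \<open>k \<ge> 2\<close>: if \<open>\<omega>\<^sub>y(n)\<close> differs from \<open>\<omega>\<^sub>k(n)\<close>, then \<open>n\<close> is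
  divisible by \<open>d\<^sup>2\<close> for some \<open>d > y\<close>, and among \<open>n \<le> N\<close> this happens at most
  \<open>N \<Sum>\<^sub>d\<^sub>>\<^sub>y 1/d\<^sup>2 \<le> N/y\<close> times (\<open>card_omega_neq_upto_le\<close>). This bound is uniform in \<open>N\<close>, which gives
  two things. The densities of \<open>\<omega>\<^sub>k(n) = m\<close> exist, because the mean values of the indicator are
  uniform limits of convergent sequences (\<open>mean_omega_indicator_tendsto\<close>). And the limits in \<open>N\<close>
  and in \<open>y\<close> can be taken at the same time: as \<open>\<omega>\<^sub>y \<le> y\<close>, the functions \<open>z^\<omega>\<^sub>y(n)\<close> and
  \<open>\<Sum>\<^sub>m\<^sub>\<le>\<^sub>y [\<omega>\<^sub>k(n) = m] z^m\<close> agree wherever \<open>\<omega>\<^sub>y(n) = \<omega>\<^sub>k(n)\<close>, and they differ by at most \<open>2\<close>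
  elsewhere when \<open>|z| \<le> 1\<close>. So the partial sum of the series up to \<open>m = y\<close> is within \<open>2/y\<close> of the
  partial product over \<open>p \<le> y\<close> (\<open>partial_sum_partial_product_diff\<close>). This works on the whole
  closed disc, with no interchange of an infinite sum and a limit.
\<close>

definition mean_upto :: "(nat \<Rightarrow> 'a::real_normed_field) \<Rightarrow> nat \<Rightarrow> 'a" where
  "mean_upto f N = (\<Sum>n=1..N. f n) / of_nat N"

text \<open>
  Stated with divisibility rather than \<^const>\<open>multiplicity\<close> so that it is periodic on all of \<^typ>\<open>nat\<close>:
  \<open>multiplicity p 0 = 0\<close> is a default value, whereas here \<open>n = 0\<close> behaves like any multiple of
  \<open>p^(k+1)\<close>.
\<close>
definition exactly_divides :: "nat \<Rightarrow> nat \<Rightarrow> nat \<Rightarrow> bool" where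
  "exactly_divides k p n \<longleftrightarrow> p ^ k dvd n \<and> \<not> p ^ Suc k dvd n"

definition omega_upto :: "nat \<Rightarrow> nat \<Rightarrow> nat \<Rightarrow> nat" where
  "omega_upto k y n = card {p \<in> {p. prime p \<and> p \<le> y}. exactly_divides k p n}"

section \<open>Mean values of periodic functions\<close>

lemma periodic_add_mult:
  assumes "\<And>n. f (n + Q) = f n"
  shows "f (n + m * Q) = f (n::nat)"
proof (induction m)
  case (Suc m)
  have "f (n + Suc m * Q) = f ((n + m * Q) + Q)" by (simp add: algebra_simps)
  then show ?case using assms Suc by simp
qed simp

lemma periodic_mod:
  assumes "\<And>n. f (n + Q) = f n"
  shows "f (n mod Q) = f (n::nat)"
proof -
  have "f (n mod Q + n div Q * Q) = f (n mod Q)"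
    using assms by (rule periodic_add_mult)
  then show ?thesis by (simp only: mod_div_mult_eq)
qed

text \<open>
  After subtracting the mean over a period, the partial sums are themselves periodic, hence bounded,
  and a bounded quantity divided by \<open>N\<close> tends to \<open>0\<close>.
\<close>
lemma mean_upto_periodic:
  fixes f :: "nat \<Rightarrow> 'a::real_normed_field"
  assumes per: "\<And>n. f (n + Q) = f n" and "Q > 0"
  shows "mean_upto f \<longlonglongrightarrow> (\<Sum>n<Q. f n) / of_nat Q"
proof -
  define c where "c = (\<Sum>n<Q. f n) / of_nat Q"
  define G where "G N = (\<Sum>n<N. f n - c)" for N
  have G0: "G Q = 0"
    using \<open>Q > 0\<close> by (simp add: G_def c_def sum_subtractf)
  have Gper: "G (N + Q) = G N" for N
  proof (induction N)
    case 0
    then show ?case using G0 by (simp add: G_def)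
  next
    case (Suc N)
    then show ?case using per[of N] by (simp add: G_def)
  qed
  define B where "B = (\<Sum>n<Q. norm (G n)) + norm (f 0 - c)"
  have GB: "norm (G N) \<le> (\<Sum>n<Q. norm (G n))" for N
  proof -
    have "norm (G (N mod Q)) \<le> (\<Sum>n<Q. norm (G n))"
      by (rule member_le_sum) (use \<open>Q > 0\<close> in auto)
    then show ?thesis by (simp add: periodic_mod[of G Q, OF Gper])
  qed
  have "norm (mean_upto f N - c) \<le> B * inverse (real N)" if "N \<ge> 1" for N
  proof -
    have "{..<Suc N} = insert 0 {1..N}" by auto
    then have "G (Suc N) = (f 0 - c) + (\<Sum>n=1..N. f n - c)"
      unfolding G_def by simp
    then have "(\<Sum>n=1..N. f n - c) = G (Suc N) - (f 0 - c)" by simp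
    also have "norm \<dots> \<le> B"
      unfolding B_def using GB[of "Suc N"] norm_triangle_ineq4[of "G (Suc N)" "f 0 - c"] by linarith
    finally have *: "norm (\<Sum>n=1..N. f n - c) \<le> B" .
    have "mean_upto f N - c = (\<Sum>n=1..N. f n - c) / of_nat N"
      using that by (simp add: mean_upto_def sum_subtractf field_simps)
    then have "norm (mean_upto f N - c) = norm (\<Sum>n=1..N. f n - c) / real N"
      by (simp add: norm_divide)
    also have "\<dots> \<le> B / real N" using * by (rule divide_right_mono) simp
    finally show ?thesis by (simp add: divide_inverse)
  qed
  then have "eventually (\<lambda>N. norm (mean_upto f N - c) \<le> B * inverse (real N)) sequentially"
    by (rule eventually_sequentiallyI)
  moreover have "(\<lambda>N. B * inverse (real N)) \<longlonglongrightarrow> 0"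
    by real_asymp
  ultimately have "(\<lambda>N. mean_upto f N - c) \<longlonglongrightarrow> 0"
    by (rule Lim_null_comparison)
  then show ?thesis
    unfolding c_def by (rule LIM_zero_cancel)
qed

lemma bij_betw_mod_pair:
  fixes a b :: nat
  assumes "coprime a b" "a > 0" "b > 0"
  shows "bij_betw (\<lambda>n. (n mod a, n mod b)) {..<a * b} ({..<a} \<times> {..<b})"
proof -
  let ?h = "\<lambda>n. (n mod a, n mod b)"
  have inj: "inj_on ?h {..<a * b}"
  proof (rule inj_onI)
    fix m n assume mn: "m \<in> {..<a * b}" "n \<in> {..<a * b}" "?h m = ?h n"
    then have "[m = n] (mod a)" "[m = n] (mod b)" by (auto simp: cong_def)
    then have "[m = n] (mod a * b)" using assms by (simp add: coprime_cong_mult_nat)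
    then show "m = n" using mn by (simp add: cong_def)
  qed
  moreover have "?h ` {..<a * b} = {..<a} \<times> {..<b}"
    by (rule card_subset_eq) (use assms inj in \<open>auto simp: card_image\<close>)
  ultimately show ?thesis by (simp add: bij_betw_def)
qed

text \<open>
  Independence of functions with coprime periods: by the Chinese remainder theorem the pair of
  residues runs through the full product as \<open>n\<close> runs through one common period.
\<close>
lemma sum_mult_periodic_coprime:
  fixes f g :: "nat \<Rightarrow> 'a::comm_semiring_1"
  assumes "coprime a b" "a > 0" "b > 0"
    and "\<And>n. f (n + a) = f n" "\<And>n. g (n + b) = g n"
  shows "(\<Sum>n<a * b. f n * g n) = (\<Sum>n<a. f n) * (\<Sum>n<b. g n)"
proof -
  have "(\<Sum>n<a * b. f n * g n) = (\<Sum>n<a * b. (\<lambda>(i, j). f i * g j) (n mod a, n mod b))"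
    using assms by (simp add: periodic_mod[of f] periodic_mod[of g])
  also have "\<dots> = (\<Sum>(i, j)\<in>{..<a} \<times> {..<b}. f i * g j)"
    by (rule sum.reindex_bij_betw[OF bij_betw_mod_pair[OF assms(1-3)]])
  also have "\<dots> = (\<Sum>n<a. f n) * (\<Sum>n<b. g n)"
    by (simp add: sum_product sum.cartesian_product)
  finally show ?thesis .
qed

lemma sum_prod_periodic_coprime:
  fixes f :: "'b \<Rightarrow> nat \<Rightarrow> 'a::comm_semiring_1" and q :: "'b \<Rightarrow> nat"
  assumes "finite S"
    and "\<And>i j. i \<in> S \<Longrightarrow> j \<in> S \<Longrightarrow> i \<noteq> j \<Longrightarrow> coprime (q i) (q j)"
    and "\<And>i. i \<in> S \<Longrightarrow> q i > 0"
    and per: "\<And>i n. i \<in> S \<Longrightarrow> f i (n + q i) = f i n"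
  shows "(\<Sum>n<(\<Prod>i\<in>S. q i). \<Prod>i\<in>S. f i n) = (\<Prod>i\<in>S. \<Sum>n<q i. f i n)"
  using assms
proof (induction S rule: finite_induct)
  case (insert i S)
  let ?Q = "\<Prod>i\<in>S. q i"
  have "(\<Prod>j\<in>S. f j (n + ?Q)) = (\<Prod>j\<in>S. f j n)" for n
  proof (rule prod.cong)
    fix j assume "j \<in> S"
    then have "?Q = (\<Prod>i\<in>S - {j}. q i) * q j"
      using insert.hyps by (simp add: prod.remove mult.commute)
    then show "f j (n + ?Q) = f j n"
      using periodic_add_mult[of "f j" "q j" n] insert.prems(3) \<open>j \<in> S\<close> by simp
  qed simp
  moreover have "coprime (q i) ?Q"
    by (rule prod_coprime_right) (use insert in auto)
  moreover have "?Q > 0"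
    using insert by (intro prod_pos) auto
  ultimately have "(\<Sum>n<q i * ?Q. f i n * (\<Prod>j\<in>S. f j n)) = (\<Sum>n<q i. f i n) * (\<Sum>n<?Q. \<Prod>j\<in>S. f j n)"
    using insert.prems by (intro sum_mult_periodic_coprime) auto
  then show ?case using insert by auto
qed simp

section \<open>The truncated statistic\<close>

lemma exactly_divides_add:
  "exactly_divides k p (n + p ^ Suc k) \<longleftrightarrow> exactly_divides k p n"
proof -
  have "p ^ k dvd p ^ Suc k" by (rule le_imp_power_dvd) simp
  then show ?thesis
    by (simp add: exactly_divides_def dvd_add_left_iff del: power_Suc)
qed

lemma exactly_divides_iff_multiplicity:
  assumes "prime p" "n > 0"
  shows "exactly_divides k p n \<longleftrightarrow> multiplicity p n = k"
proof -
  have "n \<noteq> 0" "\<not> is_unit p" using assms by (auto simp: prime_nat_iff)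
  then have pow: "p ^ j dvd n \<longleftrightarrow> j \<le> multiplicity p n" for j
    by (simp add: power_dvd_iff_le_multiplicity)
  show ?thesis unfolding exactly_divides_def pow by auto
qed

text \<open>
  The residues in question are \<open>p^k j\<close> with \<open>0 < j < p\<close>.
\<close>
lemma card_exactly_divides:
  assumes "p > 1"
  shows "card {n. n < p ^ Suc k \<and> exactly_divides k p n} = p - 1"
proof -
  have "{n. n < p ^ Suc k \<and> exactly_divides k p n} = (\<lambda>j. p ^ k * j) ` {1..<p}"
  proof (intro equalityI subsetI)
    fix n assume "n \<in> {n. n < p ^ Suc k \<and> exactly_divides k p n}"
    then obtain j where "n = p ^ k * j" "n < p ^ k * p" "\<not> p ^ Suc k dvd n"
      by (auto simp: exactly_divides_def mult.commute)
    moreover from this have "j > 0" by (intro gr0I) simp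
    moreover from calculation have "j < p" using assms by simp
    ultimately show "n \<in> (\<lambda>j. p ^ k * j) ` {1..<p}"
      by (intro image_eqI[of _ _ j]) simp_all
  next
    fix n assume "n \<in> (\<lambda>j. p ^ k * j) ` {1..<p}"
    then obtain j where j: "n = p ^ k * j" "0 < j" "j < p" by auto
    have "\<not> p dvd j" using j by (auto dest: dvd_imp_le)
    then show "n \<in> {n. n < p ^ Suc k \<and> exactly_divides k p n}"
      using j assms by (auto simp: exactly_divides_def mult.commute)
  qed
  moreover have "inj_on (\<lambda>j. p ^ k * j) {1..<p}"
    using assms by (auto simp: inj_on_def)
  ultimately show ?thesis by (simp add: card_image)
qed

lemma mean_exactly_divides:
  assumes "prime p"
  shows "(\<Sum>n<p ^ Suc k. if exactly_divides k p n then z else 1) / of_nat (p ^ Suc k)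
    = euler_factor k z p"
proof -
  have p: "p > 1" using assms by (rule prime_gt_1_nat)
  have "(\<Sum>n<p ^ Suc k. if exactly_divides k p n then z else 1)
      = (\<Sum>n<p ^ Suc k. 1 + (if exactly_divides k p n then z - 1 else 0))"
    by (rule sum.cong) auto
  also have "\<dots> = of_nat (p ^ Suc k) + of_nat (p - 1) * (z - 1)"
    by (simp add: sum.distrib card_exactly_divides[OF p] flip: sum.inter_filter del: power_Suc)
  finally show ?thesis
    using p assms by (simp add: euler_factor_def field_simps of_nat_diff)
qed

lemma power_omega_upto:
  "z ^ omega_upto k y n
    = (\<Prod>p | prime p \<and> p \<le> y. if exactly_divides k p n then z else (1::complex))"
proof -
  let ?S = "{p. prime p \<and> p \<le> y}"
  have "(\<Prod>p\<in>?S. if exactly_divides k p n then z else 1)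
      = (\<Prod>p \<in> {p \<in> ?S. exactly_divides k p n}. z)"
    by (rule prod.inter_filter[symmetric]) simp
  then show ?thesis by (simp only: omega_upto_def prod_constant)
qed

lemma omega_upto_periodic:
  fixes k y :: nat
  defines "Q \<equiv> (\<Prod>p | prime p \<and> p \<le> y. p ^ Suc k)"
  shows "omega_upto k y (n + Q) = omega_upto k y n"
proof -
  have "exactly_divides k p (n + Q) \<longleftrightarrow> exactly_divides k p n" if "prime p" "p \<le> y" for p
  proof -
    have "p ^ Suc k dvd Q"
      unfolding Q_def by (rule dvd_prodI) (use that in auto)
    then obtain m where "Q = m * p ^ Suc k" by (metis dvd_def mult.commute)
    then show ?thesis
      using periodic_add_mult[of "exactly_divides k p" "p ^ Suc k" n m]
      by (simp add: exactly_divides_add del: power_Suc)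
  qed
  then show ?thesis unfolding omega_upto_def by (metis (mono_tags, lifting) mem_Collect_eq)
qed

lemma primes_modulus_pos: "(\<Prod>p | prime p \<and> p \<le> y. p ^ Suc k) > (0::nat)"
  by (rule prod_pos) (auto simp: prime_gt_0_nat)

text \<open>
  The power \<open>z^\<omega>\<^sub>y(n)\<close> is a product of one periodic function for each prime \<open>p \<le> y\<close>, of period
  \<open>p^(k+1)\<close>; these periods are coprime, and each function has an Euler factor as its mean.
\<close>
lemma mean_omega_upto_generating:
  "mean_upto (\<lambda>n. z ^ omega_upto k y n) \<longlonglongrightarrow> (\<Prod>p\<le>y. euler_factor k z p)"
proof -
  let ?S = "{p. prime p \<and> p \<le> y}"
  let ?Q = "\<Prod>p\<in>?S. p ^ Suc k"
  have "(\<Sum>n<?Q. z ^ omega_upto k y n) = (\<Prod>p\<in>?S. \<Sum>n<p ^ Suc k. if exactly_divides k p n then z else 1)"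
    unfolding power_omega_upto
    by (rule sum_prod_periodic_coprime)
       (auto simp: exactly_divides_add primes_coprime prime_gt_0_nat simp del: power_Suc
         intro!: coprime_power_left_iff[THEN iffD2] coprime_power_right_iff[THEN iffD2])
  then have "(\<Sum>n<?Q. z ^ omega_upto k y n) / of_nat ?Q
      = (\<Prod>p\<in>?S. (\<Sum>n<p ^ Suc k. if exactly_divides k p n then z else 1) / of_nat (p ^ Suc k))"
    by (simp add: prod_dividef del: power_Suc)
  also have "\<dots> = (\<Prod>p\<in>?S. euler_factor k z p)"
    by (rule prod.cong[OF refl], rule mean_exactly_divides) simp
  also have "\<dots> = (\<Prod>p\<le>y. euler_factor k z p)"
    by (rule prod.mono_neutral_left) (auto simp: euler_factor_def)
  finally show ?thesis
    using mean_upto_periodic[OF _ primes_modulus_pos, of "\<lambda>n. z ^ omega_upto k y n" k y]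
    by (simp add: omega_upto_periodic del: power_Suc)
qed

section \<open>Truncation error\<close>

lemma omega_eq_card_exactly_divides:
  assumes "n > 0" "k > 0"
  shows "omega k n = card {p. prime p \<and> exactly_divides k p n}"
proof -
  have "{p \<in> prime_factors n. multiplicity p n = k} = {p. prime p \<and> exactly_divides k p n}"
    using assms by (auto simp: exactly_divides_iff_multiplicity prime_factors_multiplicity)
  then show ?thesis by (simp add: omega_def)
qed

text \<open>
  A prime counted by \<^const>\<open>omega\<close> but not by \<^const>\<open>omega_upto\<close> exceeds \<open>y\<close>, and its square divides
  \<open>n\<close> as \<open>k \<ge> 2\<close>.
\<close>
lemma omega_neq_upto_imp_square_dvd:
  assumes "n > 0" "k \<ge> 2" "omega k n \<noteq> omega_upto k y n"
  shows "\<exists>d>y. d\<^sup>2 dvd n"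
proof (rule ccontr)
  assume neg: "\<not> ?thesis"
  have "p \<le> y" if "exactly_divides k p n" for p
  proof -
    have "p\<^sup>2 dvd p ^ k" using \<open>k \<ge> 2\<close> by (rule le_imp_power_dvd)
    then have "p\<^sup>2 dvd n" using that dvd_trans unfolding exactly_divides_def by blast
    then show ?thesis using neg by (meson not_le)
  qed
  then have "{p. prime p \<and> exactly_divides k p n}
      = {p \<in> {p. prime p \<and> p \<le> y}. exactly_divides k p n}" by blast
  then show False
    using assms by (simp add: omega_eq_card_exactly_divides omega_upto_def)
qed

lemma sum_inverse_squares_le:
  assumes "y > 0"
  shows "(\<Sum>d\<in>{y<..N}. 1 / (real d)\<^sup>2) \<le> 1 / real y"
proof -
  have "y \<le> N \<Longrightarrow> (\<Sum>d\<in>{y<..N}. 1 / (real d)\<^sup>2) \<le> 1 / real y - 1 / real N"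
  proof (induction N rule: dec_induct)
    case (step N)
    have "{y<..Suc N} = insert (Suc N) {y<..N}" using step by auto
    moreover have "1 / (real (Suc N))\<^sup>2 \<le> 1 / real N - 1 / real (Suc N)"
    proof -
      \<comment> \<open>Comparison with a telescoping sum.\<close>
      have "1 / (real (Suc N))\<^sup>2 \<le> 1 / (real N * real (Suc N))"
        using step assms by (intro frac_le) (auto simp: power2_eq_square)
      also have "\<dots> = 1 / real N - 1 / real (Suc N)"
        using step assms by (simp add: field_simps)
      finally show ?thesis .
    qed
    ultimately show ?case using step by simp
  qed simp
  moreover have "\<not> y \<le> N \<Longrightarrow> {y<..N} = {}" by auto
  ultimately show ?thesis by (cases "y \<le> N") (auto intro: order_trans)
qed

lemma card_multiples_le:
  assumes "d > 0"
  shows "real (card {n \<in> {1..N}. d dvd n}) \<le> real N / real d"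
proof -
  have "{n \<in> {1..N}. d dvd n} \<subseteq> (\<lambda>j. d * j) ` {1..N div d}"
  proof
    fix n assume n: "n \<in> {n \<in> {1..N}. d dvd n}"
    then obtain j where j: "n = d * j" by auto
    then have "j \<le> N div d" using n assms by (simp add: less_eq_div_iff_mult_less_eq mult.commute)
    moreover have "j \<ge> 1" using n j by (cases j) auto
    ultimately show "n \<in> (\<lambda>j. d * j) ` {1..N div d}" using j by auto
  qed
  then have "card {n \<in> {1..N}. d dvd n} \<le> card {1..N div d}"
    by (rule surj_card_le[rotated]) simp
  then have "real (card {n \<in> {1..N}. d dvd n}) \<le> real (N div d)" by simp
  also have "\<dots> \<le> real N / real d" by (rule of_nat_div_le_of_nat)
  finally show ?thesis .
qed

lemma card_omega_neq_upto_le: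
  assumes "k \<ge> 2" "y > 0"
  shows "real (card {n \<in> {1..N}. omega k n \<noteq> omega_upto k y n}) \<le> real N / real y"
proof -
  let ?B = "\<lambda>d. {n \<in> {1..N}. d\<^sup>2 dvd n}"
  have "{n \<in> {1..N}. omega k n \<noteq> omega_upto k y n} \<subseteq> (\<Union>d\<in>{y<..N}. ?B d)"
  proof
    fix n assume n: "n \<in> {n \<in> {1..N}. omega k n \<noteq> omega_upto k y n}"
    then obtain d where d: "d > y" "d\<^sup>2 dvd n"
      using omega_neq_upto_imp_square_dvd[of n k y] assms by auto
    have "d \<le> d\<^sup>2" by (simp add: power2_eq_square)
    also have "\<dots> \<le> n" using d n by (intro dvd_imp_le) auto
    finally show "n \<in> (\<Union>d\<in>{y<..N}. ?B d)" using d n by auto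
  qed
  then have "card {n \<in> {1..N}. omega k n \<noteq> omega_upto k y n} \<le> card (\<Union>d\<in>{y<..N}. ?B d)"
    by (intro card_mono) auto
  also have "\<dots> \<le> (\<Sum>d\<in>{y<..N}. card (?B d))" by (rule card_UN_le) simp
  finally have "real (card {n \<in> {1..N}. omega k n \<noteq> omega_upto k y n})
      \<le> real (\<Sum>d\<in>{y<..N}. card (?B d))" by (rule of_nat_mono)
  also have "\<dots> \<le> (\<Sum>d\<in>{y<..N}. real N / real (d\<^sup>2))"
    unfolding of_nat_sum by (intro sum_mono card_multiples_le) auto
  also have "\<dots> = real N * (\<Sum>d\<in>{y<..N}. 1 / (real d)\<^sup>2)"
    by (simp add: sum_distrib_left)
  also have "\<dots> \<le> real N * (1 / real y)"
    using sum_inverse_squares_le[OF \<open>y > 0\<close>, of N] by (intro mult_left_mono) auto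
  finally show ?thesis by simp
qed

text \<open>
  The form in which the truncation error is used, both for indicators (with \<open>C = 1\<close>) and for powers
  of \<open>z\<close> (with \<open>C = 2\<close>). The point is that the bound is independent of \<open>N\<close>.
\<close>
lemma mean_upto_omega_diff_le:
  fixes f g :: "nat \<Rightarrow> 'a::real_normed_field"
  assumes "k \<ge> 2" "y > 0" and C: "\<And>n. norm (f n - g n) \<le> C"
    and eq: "\<And>n. omega k n = omega_upto k y n \<Longrightarrow> f n = g n"
  shows "norm (mean_upto f N - mean_upto g N) \<le> C / real y"
proof (cases "N = 0")
  case True
  have "C \<ge> 0" using C[of 0] norm_ge_zero[of "f 0 - g 0"] by linarith
  then show ?thesis using True by (simp add: mean_upto_def)
next
  case False
  have "C \<ge> 0" using C[of 0] norm_ge_zero[of "f 0 - g 0"] by linarith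
  have "norm (\<Sum>n=1..N. f n - g n) \<le> (\<Sum>n=1..N. if omega k n \<noteq> omega_upto k y n then C else 0)"
    by (rule sum_norm_le) (use C eq in auto)
  also have "\<dots> = real (card {n \<in> {1..N}. omega k n \<noteq> omega_upto k y n}) * C"
    by (subst sum.inter_filter[symmetric]) auto
  also have "\<dots> \<le> real N / real y * C"
    using card_omega_neq_upto_le[OF assms(1,2)] \<open>C \<ge> 0\<close> by (intro mult_right_mono) auto
  finally have "norm (\<Sum>n=1..N. f n - g n) / real N \<le> C / real y"
    using False by (simp add: field_simps)
  moreover have "mean_upto f N - mean_upto g N = (\<Sum>n=1..N. f n - g n) / of_nat N"
    by (simp add: mean_upto_def sum_subtractf diff_divide_distrib)
  ultimately show ?thesis by (simp add: norm_divide)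
qed

section \<open>Existence of the densities\<close>

lemma convergent_if_uniformly_approximated:
  fixes u :: "nat \<Rightarrow> 'a::banach"
  assumes "\<And>y. convergent (v y)" and "\<And>y N. norm (u N - v y N) \<le> \<epsilon> y"
    and "\<epsilon> \<longlonglongrightarrow> (0::real)"
  shows "convergent u"
proof -
  have "Cauchy u"
  proof (rule metric_CauchyI)
    fix e :: real assume "e > 0"
    then have "eventually (\<lambda>y. \<epsilon> y < e / 3) sequentially"
      using assms(3) by (intro order_tendstoD(2)) auto
    then obtain y where y: "\<epsilon> y < e / 3" by (auto simp: eventually_sequentially)
    obtain M where M: "\<And>m n. m \<ge> M \<Longrightarrow> n \<ge> M \<Longrightarrow> dist (v y m) (v y n) < e / 3"
      using convergent_Cauchy[OF assms(1)[of y]] \<open>e > 0\<close>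
      by (metis divide_pos_pos metric_CauchyD zero_less_numeral)
    have "dist (u m) (u n) < e" if "m \<ge> M" "n \<ge> M" for m n
    proof -
      have "dist (u m) (v y m) < e / 3" "dist (u n) (v y n) < e / 3"
        using assms(2)[of m y] assms(2)[of n y] y unfolding dist_norm by linarith+
      then show ?thesis using M[OF that]
        dist_triangle[of "u m" "u n" "v y m"] dist_triangle[of "v y m" "u n" "v y n"]
        by (simp add: dist_commute)
    qed
    then show "\<exists>M. \<forall>m\<ge>M. \<forall>n\<ge>M. dist (u m) (u n) < e" by blast
  qed
  then show ?thesis by (rule Cauchy_convergent)
qed

lemma convergent_mean_omega_indicator:
  assumes "k \<ge> 2"
  shows "convergent (mean_upto (\<lambda>n. of_bool (omega k n = m) :: real))"
proof (rule convergent_if_uniformly_approximated)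
  \<comment> \<open>The cut-off is \<open>y + 1\<close> so that the error bound makes sense for every \<open>y\<close>, including \<open>0\<close>.\<close>
  let ?v = "\<lambda>y. mean_upto (\<lambda>n. of_bool (omega_upto k (Suc y) n = m) :: real)"
  show "convergent (?v y)" for y
    using mean_upto_periodic[OF _ primes_modulus_pos,
        of "\<lambda>n. of_bool (omega_upto k (Suc y) n = m) :: real" k "Suc y"]
    unfolding convergent_def by (auto simp: omega_upto_periodic simp del: power_Suc)
  show "norm (mean_upto (\<lambda>n. of_bool (omega k n = m)) N - ?v y N) \<le> 1 / real (Suc y)" for y N
    by (rule mean_upto_omega_diff_le) (use assms in auto)
  show "(\<lambda>y. 1 / real (Suc y)) \<longlonglongrightarrow> 0"
    using LIMSEQ_inverse_real_of_nat by (simp add: inverse_eq_divide)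
qed

text \<open>
  Passes from integer to real cut-offs: for \<open>N = \<lfloor>x\<rfloor>\<close> the counts up to \<open>N\<close> and up to \<open>x\<close> coincide, and
  \<open>N/x\<close> tends to \<open>1\<close>.
\<close>
lemma natural_density_eqI:
  assumes "mean_upto (\<lambda>n. of_bool (n \<in> A)) \<longlonglongrightarrow> d"
  shows "natural_density A = d"
proof -
  let ?N = "\<lambda>x::real. nat \<lfloor>x\<rfloor>"
  have "((\<lambda>x. mean_upto (\<lambda>n. of_bool (n \<in> A)) (?N x)) \<longlongrightarrow> d) at_top"
    by (rule filterlim_compose[OF assms], rule filterlim_compose[OF filterlim_nat_sequentially],
        rule filterlim_floor_sequentially)
  moreover have "((\<lambda>x. real (?N x) / x) \<longlongrightarrow> 1) at_top"
    by real_asymp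
  ultimately have "((\<lambda>x. mean_upto (\<lambda>n. of_bool (n \<in> A)) (?N x) * (real (?N x) / x)) \<longlongrightarrow> d) at_top"
    using tendsto_mult by fastforce
  moreover have "eventually (\<lambda>x. mean_upto (\<lambda>n. of_bool (n \<in> A)) (?N x) * (real (?N x) / x)
      = real (card {n \<in> A. 1 \<le> n \<and> real n \<le> x}) / x) at_top"
    using eventually_ge_at_top[of 1]
  proof eventually_elim
    case (elim x)
    define N where "N = ?N x"
    have "{n \<in> A. 1 \<le> n \<and> real n \<le> x} = {n \<in> {1..N}. n \<in> A}"
      using elim by (auto simp: N_def le_nat_iff le_floor_iff)
    then have "(\<Sum>n=1..N. of_bool (n \<in> A)) = real (card {n \<in> A. 1 \<le> n \<and> real n \<le> x})"
      by (simp add: of_bool_def flip: sum.inter_filter)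
    moreover have "N \<noteq> 0" using elim by (simp add: N_def)
    ultimately show ?case by (simp add: mean_upto_def flip: N_def)
  qed
  ultimately have "((\<lambda>x. real (card {n \<in> A. 1 \<le> n \<and> real n \<le> x}) / x) \<longlongrightarrow> d) at_top"
    by (rule Lim_transform_eventually)
  then show ?thesis
    unfolding natural_density_def by (intro tendsto_Lim) auto
qed

lemma mean_omega_indicator_tendsto:
  assumes "k \<ge> 2"
  shows "mean_upto (\<lambda>n. of_bool (omega k n = m)) \<longlonglongrightarrow> omega_density k m"
proof -
  obtain d where d: "mean_upto (\<lambda>n. of_bool (omega k n = m)) \<longlonglongrightarrow> (d::real)"
    using convergent_mean_omega_indicator[OF assms] unfolding convergent_def by blast
  have "mean_upto (\<lambda>n. of_bool (n \<in> {n. n \<ge> 1 \<and> omega k n = m}))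
      = mean_upto (\<lambda>n. of_bool (omega k n = m) :: real)"
    unfolding mean_upto_def by (intro ext arg_cong2[where f = "(/)"] sum.cong) auto
  then have "omega_density k m = d"
    unfolding omega_density_def using d by (intro natural_density_eqI) simp
  then show ?thesis using d by simp
qed

section \<open>The generating function\<close>

text \<open>
  Only finitely many densities are involved, so this is linearity of limits. Cutting the series off
  at \<open>M\<close> is what turns it into the mean of a function of \<open>n\<close>.
\<close>
lemma mean_truncated_generating_tendsto:
  assumes "k \<ge> 2"
  shows "mean_upto (\<lambda>n. if omega k n < M then z ^ omega k n else 0)
    \<longlonglongrightarrow> (\<Sum>m<M. complex_of_real (omega_density k m) * z ^ m)"
proof -
  have "(\<lambda>N. \<Sum>m<M. complex_of_real (mean_upto (\<lambda>n. of_bool (omega k n = m)) N) * z ^ m)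
      \<longlonglongrightarrow> (\<Sum>m<M. complex_of_real (omega_density k m) * z ^ m)"
    by (intro tendsto_intros mean_omega_indicator_tendsto assms)
  moreover have "(\<Sum>m<M. complex_of_real (mean_upto (\<lambda>n. of_bool (omega k n = m)) N) * z ^ m)
      = mean_upto (\<lambda>n. if omega k n < M then z ^ omega k n else 0) N" for N
  proof -
    have "(\<Sum>m<M. complex_of_real (mean_upto (\<lambda>n. of_bool (omega k n = m)) N) * z ^ m)
      = (\<Sum>m<M. \<Sum>n=1..N. of_bool (omega k n = m) * z ^ m) / of_nat N"
      by (simp add: mean_upto_def sum_divide_distrib sum_distrib_right)
    also have "\<dots> = (\<Sum>n=1..N. \<Sum>m<M. of_bool (omega k n = m) * z ^ m) / of_nat N"
      by (subst sum.swap) simp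
    also have "(\<lambda>n. \<Sum>m<M. of_bool (omega k n = m) * z ^ m)
        = (\<lambda>n. if omega k n < M then z ^ omega k n else 0)"
      by (simp add: of_bool_def if_distrib[of "\<lambda>x. x * _"] cong: if_cong)
    finally show ?thesis by (simp add: mean_upto_def)
  qed
  ultimately show ?thesis by simp
qed

lemma omega_upto_le: "omega_upto k y n \<le> y"
proof -
  have "{p \<in> {p. prime p \<and> p \<le> y}. exactly_divides k p n} \<subseteq> {1..y}"
    by (auto dest: prime_gt_0_nat)
  then have "omega_upto k y n \<le> card {1..y}"
    unfolding omega_upto_def by (intro card_mono) auto
  then show ?thesis by simp
qed

text \<open>
  Both sides are limits of means. The two functions averaged agree whenever
  \<open>omega k n = omega_upto k y n\<close>, because this common value is at most \<open>y\<close> and thus survives the cut-off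
  at \<open>m \<le> y\<close>; the truncation error does the rest.
\<close>
lemma partial_sum_partial_product_diff:
  assumes "k \<ge> 2" "norm z \<le> 1" "y > 0"
  shows "norm ((\<Sum>m<Suc y. complex_of_real (omega_density k m) * z ^ m)
    - (\<Prod>p\<le>y. euler_factor k z p)) \<le> 2 / real y"
proof -
  let ?f = "\<lambda>n. if omega k n < Suc y then z ^ omega k n else 0"
  let ?g = "\<lambda>n. z ^ omega_upto k y n"
  have pow: "norm (z ^ j) \<le> 1" for j
    using assms by (simp add: norm_power power_le_one)
  have "norm (mean_upto ?f N - mean_upto ?g N) \<le> 2 / real y" for N
  proof (rule mean_upto_omega_diff_le[OF assms(1,3)])
    fix n
    have "norm (?f n) \<le> 1" using pow by simp
    then show "norm (?f n - ?g n) \<le> 2"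
      using pow[of "omega_upto k y n"] norm_triangle_ineq4[of "?f n" "?g n"] by linarith
    show "?f n = ?g n" if "omega k n = omega_upto k y n"
      using that omega_upto_le[of k y n] by simp
  qed
  moreover have "(\<lambda>N. norm (mean_upto ?f N - mean_upto ?g N)) \<longlonglongrightarrow>
      norm ((\<Sum>m<Suc y. complex_of_real (omega_density k m) * z ^ m) - (\<Prod>p\<le>y. euler_factor k z p))"
    by (intro tendsto_intros mean_truncated_generating_tendsto mean_omega_upto_generating assms)
  ultimately show ?thesis
    by (intro LIMSEQ_le_const2) auto
qed

text \<open>
  The Euler factor at \<open>p\<close> differs from \<open>1\<close> by at most \<open>|z - 1| / p^k\<close>, and this is summable over all
  \<open>p\<close> since \<open>k \<ge> 2\<close>; absolute convergence of the product follows.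
\<close>
lemma convergent_prod_euler_factor:
  assumes "k \<ge> 2"
  shows "convergent_prod (euler_factor k z)"
proof -
  have bound: "norm (euler_factor k z p - 1) \<le> norm (z - 1) * inverse (real p ^ k)" for p
  proof (cases "prime p")
    case True
    then have p: "p > 0" by (simp add: prime_gt_0_nat)
    have "norm (euler_factor k z p - 1) = norm (z - 1) * (real (p - 1) / real p ^ (k + 1))"
    proof -
      have "complex_of_nat p - 1 = of_nat (p - 1)" using p by (simp add: of_nat_diff)
      then show ?thesis using True
        by (simp only: euler_factor_def if_True add_diff_cancel_left' norm_mult norm_divide
            norm_power norm_of_nat times_divide_eq_right mult.commute)
    qed
    also have "real (p - 1) / real p ^ (k + 1) \<le> inverse (real p ^ k)"
      using p by (simp add: field_simps)
    finally show ?thesis by (simp add: mult_left_mono)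
  qed (simp add: euler_factor_def)
  have "summable (\<lambda>p. norm (z - 1) * inverse (real p ^ k))"
    by (intro summable_mult inverse_power_summable assms)
  then have "summable (\<lambda>p. norm (euler_factor k z p - 1))"
    by (rule summable_comparison_test'[where N = 0]) (simp add: bound)
  then show ?thesis
    by (intro abs_convergent_prod_imp_convergent_prod summable_imp_abs_convergent_prod)
qed

theorem theorem3:
  fixes k :: nat and z :: complex
  assumes "k \<ge> 2" and "norm z \<le> 1"
  shows "convergent_prod (euler_factor k z) \<and>
    (\<lambda>m. complex_of_real (omega_density k m) * z ^ m) sums (\<Prod>p. euler_factor k z p)"
proof
  show conv: "convergent_prod (euler_factor k z)"
    using convergent_prod_euler_factor assms by auto
  let ?S = "\<lambda>y. \<Sum>m<Suc y. complex_of_real (omega_density k m) * z ^ m"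
  let ?P = "\<lambda>y. \<Prod>p\<le>y. euler_factor k z p"
  have "(\<lambda>y. ?S y - ?P y) \<longlonglongrightarrow> 0"
  proof (rule Lim_null_comparison)
    show "\<forall>\<^sub>F y in sequentially. norm (?S y - ?P y) \<le> 2 * inverse (real y)"
      using eventually_gt_at_top[of 0]
      by eventually_elim (use partial_sum_partial_product_diff[OF assms] in \<open>simp add: inverse_eq_divide\<close>)
    show "(\<lambda>y. 2 * inverse (real y)) \<longlonglongrightarrow> 0"
      by real_asymp
  qed
  from tendsto_add[OF this convergent_prod_LIMSEQ[OF conv]]
  have "?S \<longlonglongrightarrow> (\<Prod>p. euler_factor k z p)" by simp
  then show "(\<lambda>m. complex_of_real (omega_density k m) * z ^ m) sums (\<Prod>p. euler_factor k z p)"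
    unfolding sums_def by (rule LIMSEQ_imp_Suc)
qed

end
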